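(* Let $x \in \mathscr{A}^{\mathbb{Z}}$ be a non-periodic Toeplitz word with separated holes, and let $\Omega$ denote the maximal equicontinuous factor of $X_x$. If there exists a factor subshift $X_{\Psi(x)} = \Psi(X_x)$ of $X_x$ with the same maximal equicontinuous factor $\Omega$ and with a point $\omega \in B_{\Psi(X)}$ that has an isolated value pair with respect to $\tau_{\Psi(x)}$, then there also exists a point $\omega' \in B_X$ that has an isolated value pair with respect to $\tau_x$.
   Context: $\mathscr{A}$ is a finite alphabet; $\mathscr{A}^{\mathbb{Z}}$ carries the product topology and the left shift $\sigma(x)(j) = x(j+1)$. A word $x \in \mathscr{A}^{\mathbb{Z}}$ is a Toeplitz word if for every $j \in \mathbb{Z}$ there is $p \in \mathbb{N}$ with $x(j) = x(j+np)$ for all $n \in \mathbb{N}$ (equivalently, all $n\in\mathbb{Z}$). $X_x$ denotes the closure of $\{\sigma^n(x) : n \in \mathbb{Z}\}$ (a Toeplitz subshift). Put $\mathrm{Per}(p,x,a) = \{j \in \mathbb{Z} : x(j+np) = a \text{ for all } n \in \mathbb{Z}\}$, $\mathrm{Per}(p,x) = \bigcup_{a \in \mathscr{A}} \mathrm{Per}(p,x,a)$ and $\mathrm{Aper}(p,x) = \mathbb{Z} \setminus \mathrm{Per}(p,x)$; elements of $\mathrm{Aper}(p,x)$ are called $p$-holes. A period structure of $x$ is a sequence $(p_l)_{l \in \mathbb{N}}$ of positive integers with (i) $p_l \mid p_{l+1}$; (ii) $\emptyset \neq \mathrm{Per}(p_l,x) \neq \mathrm{Per}(p,x)$ for all $0<p<p_l$;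 (iii) $\bigcup_l \mathrm{Per}(p_l,x) = \mathbb{Z}$. Every Toeplitz word has one. $x$ has separated holes if the minimal distance between any two distinct $p_l$-holes tends to infinity as $l \to \infty$. The maximal equicontinuous factor of $X_x$ is the associated odometer $\Omega = \varprojlim \mathbb{Z}/p_l\mathbb{Z}$ with rotation $\varrho(\omega) = \omega + (1,1,1,\dots)$. For $\omega \in \Omega$, $[\omega]_l = \{\widetilde{\omega} \in \Omega : \widetilde{\omega}(i) = \omega(i) \text{ for } 1 \le i \le l\}$. Let $\eta : \mathbb{Z} \to \Omega$, $\eta(j) = (j \bmod p_1, j \bmod p_2, \dots)$. The semicocycle of $x$ is the (continuous) map $\tau_x : \eta(\mathbb{Z}) \to \mathscr{A}$, $\eta(j) \mapsto x(j)$; $F_x \subseteq \Omega \times \mathscr{A}$ is the closure of its graph, $F_x(\omega) = \{(\omega,a) \in F_x : a \in \mathscr{A}\}$, and $B_X$ is the set of all $\omega \in \Omega$ for which $F_x(\omega)$ is not a singleton. Letters $a \neq b$ in $\mathscr{A}$ are an isolated value pair for $\omega \in \Omega$ with respect to $\tau_x$ if there is $l \in \mathbb{N}$ with $\{\widetilde{\omega} \in [\omega]_l : (\widetilde{\omega},a), (\widetilde{\omega},b) \in F_x(\widetilde{\omega})\} = \{\omega\}$. A factor map between subshifts is a continuous surjective shift-commuting map; it is given by a sliding block code $\psi : \mathscr{A}^{[-J,J]} \to \mathscr{A}$ via $\Psi(x)(j) = \psi(x[j-J,j+J])$. A factor $\Psi(X_x)$ of a Toeplitz subshift is the Toeplitz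 subshift $X_{\Psi(x)}$. "The same maximal equicontinuous factor" means that the odometer associated to $\Psi(x)$ is isomorphic to $\Omega$, identified with it via $\eta$ (the image of $j$ in one odometer corresponds to the image of $j$ in the other). $\tau_{\Psi(x)}$, $F_{\Psi(x)}$, $B_{\Psi(X)}$ and isolated value pairs with respect to $\tau_{\Psi(x)}$ are defined in the same way, using $\eta(j) \mapsto \Psi(x)(j)$. *)

theory Defs
  imports "HOL-Analysis.Analysis"
begin

text \<open>
  The alphabet is a finite type with the discrete topology, so that the topology of the function
  type \<^typ>\<open>int \<Rightarrow> 'a\<close> is the product topology on the full shift.
\<close>

definition shift :: "(int \<Rightarrow> 'a) \<Rightarrow> int \<Rightarrow> 'a" where
  "shift x = (\<lambda>j. x (j + 1))"

definition periodic_word :: "(int \<Rightarrow> 'a) \<Rightarrow> bool" where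
  "periodic_word x \<longleftrightarrow> (\<exists>p::nat. p > 0 \<and> (\<forall>j. x (j + int p) = x j))"

definition toeplitz_word :: "(int \<Rightarrow> 'a) \<Rightarrow> bool" where
  "toeplitz_word x \<longleftrightarrow> (\<forall>j. \<exists>p::nat. p > 0 \<and> (\<forall>n::nat. x j = x (j + int n * int p)))"

text \<open>The term \<open>\<lambda>j. x (j + n)\<close> is the \<open>n\<close>-th iterate of the shift at \<open>x\<close>, for \<open>n\<close> of either sign.\<close>

definition subshift :: "(int \<Rightarrow> 'a::{finite,discrete_topology}) \<Rightarrow> (int \<Rightarrow> 'a) set" where
  "subshift x = closure {(\<lambda>j. x (j + n)) | n. n \<in> (UNIV :: int set)}"

definition factor_map ::
  "((int \<Rightarrow> 'a::{finite,discrete_topology}) \<Rightarrow> (int \<Rightarrow> 'a)) \<Rightarrow>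
   (int \<Rightarrow> 'a) set \<Rightarrow> (int \<Rightarrow> 'a) set \<Rightarrow> bool" where
  "factor_map \<Psi> X Y \<longleftrightarrow>
     continuous_on X \<Psi> \<and> \<Psi> ` X = Y \<and> (\<forall>z\<in>X. \<Psi> (shift z) = shift (\<Psi> z))"

definition Per_letter :: "nat \<Rightarrow> (int \<Rightarrow> 'a) \<Rightarrow> 'a \<Rightarrow> int set" where
  "Per_letter p x a = {j. \<forall>n::int. x (j + n * int p) = a}"

definition Per :: "nat \<Rightarrow> (int \<Rightarrow> 'a) \<Rightarrow> int set" where
  "Per p x = (\<Union>a. Per_letter p x a)"

definition Aper :: "nat \<Rightarrow> (int \<Rightarrow> 'a) \<Rightarrow> int set" where
  "Aper p x = UNIV - Per p x"

definition period_structure :: "(nat \<Rightarrow> nat) \<Rightarrow> (int \<Rightarrow> 'a) \<Rightarrow> bool" where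
  "period_structure p x \<longleftrightarrow>
     (\<forall>l. p l > 0) \<and>
     (\<forall>l. p l dvd p (Suc l)) \<and>
     (\<forall>l. Per (p l) x \<noteq> {} \<and> (\<forall>q. 0 < q \<and> q < p l \<longrightarrow> Per (p l) x \<noteq> Per q x)) \<and>
     (\<Union>l. Per (p l) x) = UNIV"

text \<open>The minimal distance between distinct \<open>p l\<close>-holes tends to infinity.\<close>

definition separated_holes :: "(nat \<Rightarrow> nat) \<Rightarrow> (int \<Rightarrow> 'a) \<Rightarrow> bool" where
  "separated_holes p x \<longleftrightarrow>
     (\<forall>d::int. \<forall>\<^sub>F l in sequentially.
        \<forall>j\<in>Aper (p l) x. \<forall>k\<in>Aper (p l) x. j \<noteq> k \<longrightarrow> d \<le> \<bar>j - k\<bar>)"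

text \<open>
  The inverse limit of the groups of integers modulo \<open>p l\<close>, whose elements are represented by
  their residues in \<open>{0..<p l}\<close>. Since \<^typ>\<open>int\<close> is discrete, its topology is the subspace
  topology of \<^typ>\<open>nat \<Rightarrow> int\<close>.
\<close>

definition odometer :: "(nat \<Rightarrow> nat) \<Rightarrow> (nat \<Rightarrow> int) set" where
  "odometer p = {\<omega>. \<forall>l. 0 \<le> \<omega> l \<and> \<omega> l < int (p l) \<and> \<omega> (Suc l) mod int (p l) = \<omega> l}"

definition rotation :: "(nat \<Rightarrow> nat) \<Rightarrow> (nat \<Rightarrow> int) \<Rightarrow> nat \<Rightarrow> int" where
  "rotation p \<omega> = (\<lambda>l. (\<omega> l + 1) mod int (p l))"

definition eta :: "(nat \<Rightarrow> nat) \<Rightarrow> int \<Rightarrow> nat \<Rightarrow> int" where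
  "eta p j = (\<lambda>l. j mod int (p l))"

definition same_odometer :: "(nat \<Rightarrow> nat) \<Rightarrow> (nat \<Rightarrow> nat) \<Rightarrow> bool" where
  "same_odometer p q \<longleftrightarrow>
     (\<exists>h h'. homeomorphism (odometer p) (odometer q) h h' \<and>
        (\<forall>\<omega>\<in>odometer p. h (rotation p \<omega>) = rotation q (h \<omega>)) \<and>
        (\<forall>j. h (eta p j) = eta q j))"

text \<open>The coordinates \<open>1, ..., l + 1\<close> of the usual indexing are \<open>0, ..., l\<close> here; the sets
  \<open>cylinder p \<omega> l\<close> for \<open>l \<ge> 0\<close> are those usually indexed by \<open>l \<ge> 1\<close>.\<close>

definition cylinder :: "(nat \<Rightarrow> nat) \<Rightarrow> (nat \<Rightarrow> int) \<Rightarrow> nat \<Rightarrow> (nat \<Rightarrow> int) set" where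
  "cylinder p \<omega> l = {\<omega>' \<in> odometer p. \<forall>i\<le>l. \<omega>' i = \<omega> i}"

text \<open>
  The graph of \<open>eta p j \<mapsto> x j\<close>. It is single-valued if \<open>eta p\<close> is injective, that is, if \<open>p\<close> is
  unbounded, as is the case for a period structure of a non-periodic word. The word \<open>x\<close> need not
  be the one that \<open>p\<close> belongs to: for a factor with the same odometer, the semicocycle of
  the image word is taken over the odometer of the original word.
\<close>

definition semicocycle_graph :: "(nat \<Rightarrow> nat) \<Rightarrow> (int \<Rightarrow> 'a) \<Rightarrow> ((nat \<Rightarrow> int) \<times> 'a) set" where
  "semicocycle_graph p x = {(eta p j, x j) | j. j \<in> UNIV}"

definition graph_closure ::
  "(nat \<Rightarrow> nat) \<Rightarrow> (int \<Rightarrow> 'a::{finite,discrete_topology}) \<Rightarrow> ((nat \<Rightarrow> int) \<times> 'a) set" where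
  "graph_closure p x = closure (semicocycle_graph p x)"

definition graph_fibre ::
  "(nat \<Rightarrow> nat) \<Rightarrow> (int \<Rightarrow> 'a::{finite,discrete_topology}) \<Rightarrow> (nat \<Rightarrow> int) \<Rightarrow>
   ((nat \<Rightarrow> int) \<times> 'a) set" where
  "graph_fibre p x \<omega> = {(\<omega>, a) | a. (\<omega>, a) \<in> graph_closure p x}"

definition nonsingleton_points ::
  "(nat \<Rightarrow> nat) \<Rightarrow> (int \<Rightarrow> 'a::{finite,discrete_topology}) \<Rightarrow> (nat \<Rightarrow> int) set" where
  "nonsingleton_points p x = {\<omega> \<in> odometer p. \<not> is_singleton (graph_fibre p x \<omega>)}"

definition isolated_value_pair ::
  "(nat \<Rightarrow> nat) \<Rightarrow> (int \<Rightarrow> 'a::{finite,discrete_topology}) \<Rightarrow> (nat \<Rightarrow> int) \<Rightarrow> 'a \<Rightarrow> 'a \<Rightarrow> bool"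
where
  "isolated_value_pair p x \<omega> a b \<longleftrightarrow>
     a \<noteq> b \<and>
     (\<exists>l. {\<omega>' \<in> cylinder p \<omega> l. (\<omega>', a) \<in> graph_closure p x \<and> (\<omega>', b) \<in> graph_closure p x} = {\<omega>})"

end

theory Submission
  imports Defs
begin

text \<open>
  By compactness the factor word \<open>y = \<Psi> x\<close> is given by a block code of some radius \<open>J\<close>. Let
  \<open>a, b\<close> be an isolated value pair for \<open>\<omega>\<close> and take \<open>l\<close> so large that distinct \<open>p l\<close>-holes of
  \<open>x\<close> are more than \<open>2 J\<close> apart. The window of radius \<open>J\<close> around \<open>\<omega> l\<close> then contains at most
  one hole, and it contains at least one, since otherwise \<open>y\<close> would be constant on the residue
  class \<open>\<omega> l\<close> modulo \<open>p l\<close>. If this hole is \<open>\<omega> l + k\<close>, then on that residue class \<open>y j\<close> is a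
  function of the single letter \<open>x (j + k)\<close>. Letters \<open>c, d\<close> that this function sends to \<open>a, b\<close>
  and that are values over \<open>\<omega> + k\<close> form an isolated value pair for \<open>\<omega> + k\<close>, because translation
  by \<open>-k\<close> carries any other point near \<open>\<omega> + k\<close> at which both values occur to a point near \<open>\<omega>\<close>
  at which both \<open>a\<close> and \<open>b\<close> occur.
\<close>

subsection \<open>Products of discrete spaces\<close>

lemma open_fun_discrete_contains_cylinder:
  fixes U :: "('i \<Rightarrow> 'b::discrete_topology) set"
  assumes "open U" "f \<in> U"
  obtains I where "finite I" "\<And>g. (\<And>i. i \<in> I \<Longrightarrow> g i = f i) \<Longrightarrow> g \<in> U"
proof -
  have "openin (product_topology (\<lambda>i. euclidean) UNIV) U"
    using assms(1) by (simp add: euclidean_product_topology)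
  from product_topology_open_contains_basis[OF this assms(2)]
  have "\<exists>X. f \<in> (\<Pi>\<^sub>E i\<in>UNIV. X i) \<and> (\<forall>i. open (X i)) \<and> finite {i. X i \<noteq> (UNIV :: 'b set)} \<and>
    (\<Pi>\<^sub>E i\<in>UNIV. X i) \<subseteq> U"
    by simp
  then obtain X where X: "f \<in> (\<Pi>\<^sub>E i\<in>UNIV. X i)" "finite {i. X i \<noteq> (UNIV :: 'b set)}"
    "(\<Pi>\<^sub>E i\<in>UNIV. X i) \<subseteq> U"
    by (elim exE conjE)
  show thesis
  proof (rule that[OF X(2)])
    fix g assume g: "\<And>i. i \<in> {i. X i \<noteq> UNIV} \<Longrightarrow> g i = f i"
    have "g i \<in> X i" for i
      using g[of i] PiE_mem[OF X(1), of i] by (cases "X i = UNIV") simp_all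
    then have "g \<in> (\<Pi>\<^sub>E i\<in>UNIV. X i)" by (simp add: PiE_UNIV_domain)
    then show "g \<in> U" using X(3) by (rule rev_subsetD)
  qed
qed

lemma open_fun_discrete_cylinder:
  fixes f :: "'i \<Rightarrow> 'b::discrete_topology"
  assumes "finite I"
  shows "open {g. \<forall>i\<in>I. g i = f i}"
proof -
  have "{g. \<forall>i\<in>I. g i = f i} = (\<Inter>i\<in>I. (\<lambda>g. g i) -` {f i})" by auto
  moreover have "open ((\<lambda>g. g i) -` {f i})" for i
    by (intro open_vimage open_discrete continuous_on_product_coordinates)
  ultimately show ?thesis using assms by auto
qed

lemma compact_UNIV_fun_finite:
  "compact (UNIV :: ('i \<Rightarrow> 'b::{finite,discrete_topology}) set)"
proof -
  have "compact_space (product_topology (\<lambda>i::'i. euclidean :: 'b topology) UNIV)"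
    by (subst compact_space_product_topology) (simp add: compact_space_def finite_imp_compact)
  then show ?thesis
    by (simp add: euclidean_product_topology compact_space_def)
qed

text \<open>Uniform continuity for discrete values: continuity gives each point \<open>z\<close> of
  \<open>X\<close> a window on which agreement with \<open>z\<close> fixes the value of
  \<open>f\<close>. Finitely many of the resulting cylinders cover \<open>X\<close>, and their
  largest radius serves all pairs.\<close>

lemma continuous_on_discrete_finite_window:
  fixes f :: "(int \<Rightarrow> 'b::discrete_topology) \<Rightarrow> 'c::discrete_topology"
  assumes "compact X" "continuous_on X f"
  obtains J :: int where "J \<ge> 0"
    "\<And>u v. u \<in> X \<Longrightarrow> v \<in> X \<Longrightarrow> (\<And>m. \<bar>m\<bar> \<le> J \<Longrightarrow> u m = v m) \<Longrightarrow> f u = f v"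
proof -
  have "\<exists>J::int. \<forall>u\<in>X. (\<forall>m\<in>{-J..J}. u m = z m) \<longrightarrow> f u = f z" if z: "z \<in> X" for z
  proof -
    have "open {f z}" by (rule open_discrete)
    then obtain U where U: "open U" "U \<inter> X = f -` {f z} \<inter> X"
      using assms(2) unfolding continuous_on_open_invariant by blast
    have "z \<in> U" using z U(2) by blast
    from open_fun_discrete_contains_cylinder[OF U(1) this] obtain I where
      I: "finite I" "\<And>g. (\<And>i. i \<in> I \<Longrightarrow> g i = z i) \<Longrightarrow> g \<in> U" by blast
    \<comment> \<open>Inserting 0 keeps \<open>Max\<close> meaningful when \<open>I\<close> is
      empty; the same device recurs below and there also yields \<open>J \<ge> 0\<close>.\<close>
    define J where "J = Max (insert 0 (abs ` I))"
    have "i \<in> {-J..J}" if "i \<in> I" for i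
    proof -
      have "\<bar>i\<bar> \<le> J" unfolding J_def using I(1) that by (intro Max_ge) auto
      then show ?thesis by auto
    qed
    then have "u \<in> U" if "\<forall>m\<in>{-J..J}. u m = z m" for u
      using I(2) that by blast
    then have "f u = f z" if "u \<in> X" "\<forall>m\<in>{-J..J}. u m = z m" for u
      using that U(2) by blast
    then show ?thesis by blast
  qed
  then obtain r :: "(int \<Rightarrow> 'b) \<Rightarrow> int" where
    "\<forall>z\<in>X. \<forall>u\<in>X. (\<forall>m\<in>{-r z..r z}. u m = z m) \<longrightarrow> f u = f z"
    using bchoice[of X "\<lambda>z J. \<forall>u\<in>X. (\<forall>m\<in>{-J..J}. u m = z m) \<longrightarrow> f u = f z"] by blast
  then have r: "f u = f z" if "z \<in> X" "u \<in> X" "\<forall>m\<in>{-r z..r z}. u m = z m" for z u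
    using that by blast
  define C where "C z = {u. \<forall>m\<in>{-r z..r z}. u m = z m}" for z
  have C_open: "open (C z)" for z
    unfolding C_def by (rule open_fun_discrete_cylinder) simp
  have "X \<subseteq> (\<Union>z\<in>X. C z)" by (auto simp: C_def)
  from compactE_image[OF assms(1) C_open this]
  obtain D where D: "D \<subseteq> X" "finite D" "X \<subseteq> (\<Union>z\<in>D. C z)" .
  define J where "J = Max (insert 0 (r ` D))"
  have rJ: "r z \<le> J" if "z \<in> D" for z
    unfolding J_def using D(2) that by (intro Max_ge) auto
  show thesis
  proof (rule that)
    show "J \<ge> 0" unfolding J_def using D(2) by (intro Max_ge) auto
  next
    fix u v assume uv: "u \<in> X" "v \<in> X" "\<And>m. \<bar>m\<bar> \<le> J \<Longrightarrow> u m = v m"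
    obtain z where z: "z \<in> D" "u \<in> C z" using D(3) uv(1) by blast
    have "v m = z m" if "m \<in> {-r z..r z}" for m
      using uv(3)[of m] rJ[OF z(1)] that z(2) by (auto simp: C_def)
    then have "f v = f z" using z(1) D(1) uv(2) by (intro r) blast+
    moreover have "f u = f z" using z D(1) uv(1) unfolding C_def by (intro r) blast+
    ultimately show "f u = f v" by simp
  qed
qed

subsection \<open>Factor maps as block codes\<close>

lemma translate_in_subshift: "(\<lambda>j. x (j + n)) \<in> subshift x"
  unfolding subshift_def by (rule subsetD[OF closure_subset]) blast

lemma factor_map_translate:
  assumes "factor_map \<Psi> (subshift x) Y"
  shows "\<Psi> (\<lambda>j. x (j + n)) = (\<lambda>j. \<Psi> x (j + n))"
proof -
  have step: "\<Psi> (\<lambda>j. x (j + (n + 1))) = shift (\<Psi> (\<lambda>j. x (j + n)))" for n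
  proof -
    have "shift (\<lambda>j. x (j + n)) = (\<lambda>j. x (j + (n + 1)))"
      by (auto simp: shift_def algebra_simps)
    then show ?thesis
      using assms translate_in_subshift[of x n] unfolding factor_map_def by metis
  qed
  show ?thesis
  proof (induction n rule: int_induct[where k = 0])
    case base
    show ?case by simp
  next
    case (step1 i)
    then show ?case unfolding step[of i] by (simp add: shift_def ac_simps)
  next
    case (step2 i)
    \<comment> \<open>Downward step: commutation with the shift is used at \<open>i - 1\<close>, and
      the shift is then undone by reading the equation at \<open>j - 1\<close>.\<close>
    have eq: "shift (\<Psi> (\<lambda>j. x (j + (i - 1)))) = (\<lambda>j. \<Psi> x (j + i))"
      using step[of "i - 1"] step2(2) by simp
    show ?case
    proof
      fix j
      show "\<Psi> (\<lambda>j. x (j + (i - 1))) j = \<Psi> x (j + (i - 1))"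
        using fun_cong[OF eq, of "j - 1"] by (simp add: shift_def algebra_simps)
    qed
  qed
qed

text \<open>Curtis-Hedlund-Lyndon along the orbit of \<open>x\<close>: coordinate 0 of
  \<open>\<Psi>\<close> depends on a finite window, and translating \<open>x\<close> by
  \<open>i\<close> brings position \<open>i\<close> to coordinate 0.\<close>

lemma factor_map_block_code:
  fixes x :: "int \<Rightarrow> 'a::{finite,discrete_topology}"
  assumes "factor_map \<Psi> (subshift x) Y"
  obtains J :: int where "J \<ge> 0"
    "\<And>i j. (\<And>m. \<bar>m\<bar> \<le> J \<Longrightarrow> x (i + m) = x (j + m)) \<Longrightarrow> \<Psi> x i = \<Psi> x j"
proof -
  have "compact (subshift x)"
    using compact_Int_closed[OF compact_UNIV_fun_finite, of "subshift x"]
    by (simp add: subshift_def)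
  moreover have "continuous_on (subshift x) (\<lambda>z. \<Psi> z 0)"
    using assms unfolding factor_map_def by (blast intro: continuous_on_product_then_coordinatewise)
  ultimately obtain J :: int where J: "J \<ge> 0"
    "\<And>u v. u \<in> subshift x \<Longrightarrow> v \<in> subshift x \<Longrightarrow> (\<And>m. \<bar>m\<bar> \<le> J \<Longrightarrow> u m = v m) \<Longrightarrow> \<Psi> u 0 = \<Psi> v 0"
    by (rule continuous_on_discrete_finite_window) blast
  show thesis
  proof (rule that[OF J(1)])
    fix i j assume "\<And>m. \<bar>m\<bar> \<le> J \<Longrightarrow> x (i + m) = x (j + m)"
    then have "\<Psi> (\<lambda>m. x (m + i)) 0 = \<Psi> (\<lambda>m. x (m + j)) 0"
      by (intro J(2) translate_in_subshift) (simp add: add.commute)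
    then show "\<Psi> x i = \<Psi> x j"
      by (simp add: factor_map_translate[OF assms])
  qed
qed

subsection \<open>Odometers and the closure of the semicocycle graph\<close>

lemma odometer_mod:
  assumes "\<And>l. p l dvd p (Suc l)" "\<omega> \<in> odometer p" "l \<le> m"
  shows "\<omega> m mod int (p l) = \<omega> l"
  using assms(3)
proof (induction m rule: dec_induct)
  case base
  show ?case using assms(2) by (simp add: odometer_def)
next
  case (step m)
  have "int (p l) dvd int (p m)"
    using step(1) assms(1) by (induction m rule: dec_induct) (auto intro: dvd_trans)
  then have "\<omega> (Suc m) mod int (p l) = (\<omega> (Suc m) mod int (p m)) mod int (p l)"
    by (simp add: mod_mod_cancel)
  also have "\<omega> (Suc m) mod int (p m) = \<omega> m"
    using assms(2) by (simp add: odometer_def)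
  finally show ?case using step(3) by simp
qed

lemma mod_odometer_mono:
  assumes "\<And>l. p l dvd p (Suc l)" "\<omega> \<in> odometer p" "l \<le> m" "j mod int (p m) = \<omega> m"
  shows "j mod int (p l) = \<omega> l"
proof -
  have "int (p l) dvd int (p m)"
    using assms(3,1) by (induction m rule: dec_induct) (auto intro: dvd_trans)
  then show ?thesis
    using odometer_mod[OF assms(1-3)] assms(4) by (metis mod_mod_cancel)
qed

text \<open>A coordinate of an odometer point determines all earlier ones, so residue classes modulo
  a single \<open>p l\<close> give a neighbourhood basis, and the letter \<open>a\<close> is itself
  an open set. This turns the topology into arithmetic, for any word over this odometer.\<close>

lemma graph_closure_iff:
  assumes dvd: "\<And>l. p l dvd p (Suc l)" and \<omega>: "\<omega> \<in> odometer p"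
  shows "(\<omega>, a) \<in> graph_closure p x \<longleftrightarrow> (\<forall>l. \<exists>j. j mod int (p l) = \<omega> l \<and> x j = a)"
proof
  assume cl: "(\<omega>, a) \<in> graph_closure p x"
  show "\<forall>l. \<exists>j. j mod int (p l) = \<omega> l \<and> x j = a"
  proof
    fix l
    have "open ({g. \<forall>i\<in>{l}. g i = \<omega> i} \<times> {a})"
      by (intro open_Times open_fun_discrete_cylinder open_discrete) simp
    then have "({g. \<forall>i\<in>{l}. g i = \<omega> i} \<times> {a}) \<inter> semicocycle_graph p x \<noteq> {}"
      using cl open_Int_closure_eq_empty unfolding graph_closure_def by blast
    then show "\<exists>j. j mod int (p l) = \<omega> l \<and> x j = a"
      by (auto simp: semicocycle_graph_def eta_def)
  qed
next
  assume *: "\<forall>l. \<exists>j. j mod int (p l) = \<omega> l \<and> x j = a"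
  have "semicocycle_graph p x \<inter> S \<noteq> {}" if S: "open S" "(\<omega>, a) \<in> S" for S
  proof -
    obtain A B where AB: "open A" "open B" "(\<omega>, a) \<in> A \<times> B" "A \<times> B \<subseteq> S"
      using S by (rule open_prod_elim) blast
    obtain I where I: "finite I" "\<And>g. (\<And>i. i \<in> I \<Longrightarrow> g i = \<omega> i) \<Longrightarrow> g \<in> A"
      using open_fun_discrete_contains_cylinder[OF AB(1), of \<omega>] AB(3) by blast
    obtain j where j: "j mod int (p (Max (insert 0 I))) = \<omega> (Max (insert 0 I))" "x j = a"
      using * by blast
    have "eta p j \<in> A"
    proof (rule I(2))
      fix i assume "i \<in> I"
      then have "i \<le> Max (insert 0 I)" using I(1) by (intro Max_ge) auto
      from mod_odometer_mono[OF dvd \<omega> this j(1)] show "eta p j i = \<omega> i"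
        by (simp add: eta_def)
    qed
    then have "(eta p j, x j) \<in> S" using AB j(2) by blast
    then show ?thesis by (auto simp: semicocycle_graph_def)
  qed
  then show "(\<omega>, a) \<in> graph_closure p x"
    unfolding graph_closure_def closure_iff_nhds_not_empty by (metis Int_mono order_refl subset_empty)
qed

text \<open>Translation by \<open>eta p k\<close>, that is, the \<open>k\<close>-th iterate of
  \<open>rotation p\<close>, with negative \<open>k\<close> allowed.\<close>

definition odometer_add :: "(nat \<Rightarrow> nat) \<Rightarrow> (nat \<Rightarrow> int) \<Rightarrow> int \<Rightarrow> nat \<Rightarrow> int" where
  "odometer_add p \<omega> k = (\<lambda>l. (\<omega> l + k) mod int (p l))"

lemma odometer_add_in_odometer:
  assumes "\<And>l. p l > 0" "\<And>l. p l dvd p (Suc l)" "\<omega> \<in> odometer p"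
  shows "odometer_add p \<omega> k \<in> odometer p"
proof -
  have "((\<omega> (Suc l) + k) mod int (p (Suc l))) mod int (p l) = (\<omega> l + k) mod int (p l)" for l
  proof -
    have "\<omega> (Suc l) mod int (p l) = \<omega> l" using assms(3) by (simp add: odometer_def)
    then show ?thesis
      using assms(2)[of l] by (metis int_dvd_int_iff mod_add_left_eq mod_mod_cancel)
  qed
  then show ?thesis
    using assms(1) by (auto simp: odometer_def odometer_add_def)
qed

lemma odometer_add_add:
  "odometer_add p (odometer_add p \<omega> k) k' = odometer_add p \<omega> (k + k')"
  by (auto simp: odometer_add_def mod_simps add.assoc)

lemma odometer_add_0: "\<omega> \<in> odometer p \<Longrightarrow> odometer_add p \<omega> 0 = \<omega>"
  by (rule ext) (simp add: odometer_def odometer_add_def)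

lemma mod_eq_odometer_add:
  "j mod int (p l) = \<omega> l \<Longrightarrow> (j + k) mod int (p l) = odometer_add p \<omega> k l"
  unfolding odometer_add_def by (metis mod_add_left_eq)

text \<open>Pigeonhole over the finite alphabet. Keeping \<open>x (j + k) = c\<close> and
  \<open>y j = a\<close> at the same \<open>j\<close> records that the letter \<open>c\<close> at
  offset \<open>k\<close> occurs together with the output \<open>a\<close> on every residue class
  around \<open>\<omega>\<close>.\<close>

lemma graph_closure_lift:
  fixes x :: "int \<Rightarrow> 'a::{finite,discrete_topology}"
  assumes pos: "\<And>l. p l > 0" and dvd: "\<And>l. p l dvd p (Suc l)" and \<omega>: "\<omega> \<in> odometer p"
    and "(\<omega>, a) \<in> graph_closure p y"
  obtains c where "(odometer_add p \<omega> k, c) \<in> graph_closure p x"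
    "\<And>l. \<exists>j. j mod int (p l) = \<omega> l \<and> x (j + k) = c \<and> y j = a"
proof -
  have ya: "\<exists>j. j mod int (p l) = \<omega> l \<and> y j = a" for l
    using assms(4) graph_closure_iff[OF dvd \<omega>] by blast
  have "\<exists>c. \<forall>l. \<exists>j. j mod int (p l) = \<omega> l \<and> x (j + k) = c \<and> y j = a"
  proof (rule ccontr)
    assume "\<not> ?thesis"
    \<comment> \<open>If each letter \<open>c\<close> fails at some level \<open>r c\<close>, then
      all letters fail at the largest of these levels, although \<open>a\<close> still occurs
      there.\<close>
    then obtain r where r: "\<And>c j. j mod int (p (r c)) = \<omega> (r c) \<Longrightarrow> x (j + k) = c \<Longrightarrow> y j \<noteq> a"
      by metis
    obtain j where j: "j mod int (p (Max (range r))) = \<omega> (Max (range r))" "y j = a"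
      using ya by blast
    have "r (x (j + k)) \<le> Max (range r)" by (intro Max_ge) auto
    from mod_odometer_mono[OF dvd \<omega> this j(1)] r j(2) show False by blast
  qed
  then obtain c where c: "\<And>l. \<exists>j. j mod int (p l) = \<omega> l \<and> x (j + k) = c \<and> y j = a" by blast
  have "(odometer_add p \<omega> k, c) \<in> graph_closure p x"
    unfolding graph_closure_iff[OF dvd odometer_add_in_odometer[OF pos dvd \<omega>]]
    using c mod_eq_odometer_add by blast
  then show thesis using c that by blast
qed

text \<open>Cylinders around \<open>\<omega>\<close> shrink but keep \<open>\<omega>\<close>, so
  isolation persists at higher levels and the level can also be chosen to separate the
  holes.\<close>

lemma isolated_value_pair_large_level:
  assumes "isolated_value_pair p y \<omega> a b"
  obtains L where "\<And>l. l \<ge> L \<Longrightarrow>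
    {\<omega>' \<in> cylinder p \<omega> l. (\<omega>', a) \<in> graph_closure p y \<and> (\<omega>', b) \<in> graph_closure p y} = {\<omega>}"
proof -
  obtain L where L:
    "{\<omega>' \<in> cylinder p \<omega> L. (\<omega>', a) \<in> graph_closure p y \<and> (\<omega>', b) \<in> graph_closure p y} = {\<omega>}"
    using assms unfolding isolated_value_pair_def by blast
  show thesis
  proof (rule that)
    fix l assume "l \<ge> L"
    then have "cylinder p \<omega> l \<subseteq> cylinder p \<omega> L" by (auto simp: cylinder_def)
    moreover have "\<omega> \<in> cylinder p \<omega> l" using L by (auto simp: cylinder_def)
    ultimately show
      "{\<omega>' \<in> cylinder p \<omega> l. (\<omega>', a) \<in> graph_closure p y \<and> (\<omega>', b) \<in> graph_closure p y} = {\<omega>}"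
      using L by blast
  qed
qed

lemma Per_mod_eq:
  assumes "j \<in> Per p x" "i mod int p = j mod int p"
  shows "x i = x j"
proof -
  obtain c where c: "\<And>n. x (j + n * int p) = c"
    using assms(1) by (auto simp: Per_def Per_letter_def)
  obtain n where "i = j + n * int p"
    using assms(2) by (metis mod_eqE mult.commute)
  then show ?thesis using c[of n] c[of 0] by simp
qed

section \<open>Transfer of isolated value pairs from the factor to \<open>x\<close>\<close>

theorem theorem5p4:
  fixes x :: "int \<Rightarrow> 'a::{finite,discrete_topology}"
    and p :: "nat \<Rightarrow> nat"
  assumes "toeplitz_word x"
    and "\<not> periodic_word x"
    and "period_structure p x"
    and "separated_holes p x"
    and "\<exists>\<Psi> q. factor_map \<Psi> (subshift x) (subshift (\<Psi> x)) \<and>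
           period_structure q (\<Psi> x) \<and> same_odometer p q \<and>
           (\<exists>\<omega>\<in>nonsingleton_points p (\<Psi> x). \<exists>a b. isolated_value_pair p (\<Psi> x) \<omega> a b)"
  shows "\<exists>\<omega>'\<in>nonsingleton_points p x. \<exists>a b. isolated_value_pair p x \<omega>' a b"
proof -
  obtain \<Psi> \<omega> a b where \<Psi>: "factor_map \<Psi> (subshift x) (subshift (\<Psi> x))"
    and \<omega>: "\<omega> \<in> odometer p" and iso: "isolated_value_pair p (\<Psi> x) \<omega> a b"
    using assms(5) by (auto simp: nonsingleton_points_def)
  define y where "y = \<Psi> x"
  have pos: "\<And>l. p l > 0" and dvd: "\<And>l. p l dvd p (Suc l)"
    using assms(3) by (auto simp: period_structure_def)
  have "a \<noteq> b" using iso by (simp add: isolated_value_pair_def)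
  obtain J :: int where "J \<ge> 0" and
    code: "\<And>i j. (\<And>m. \<bar>m\<bar> \<le> J \<Longrightarrow> x (i + m) = x (j + m)) \<Longrightarrow> y i = y j"
    using factor_map_block_code[OF \<Psi>] unfolding y_def by blast
  obtain L where L: "\<And>l. l \<ge> L \<Longrightarrow>
    {\<omega>' \<in> cylinder p \<omega> l. (\<omega>', a) \<in> graph_closure p y \<and> (\<omega>', b) \<in> graph_closure p y} = {\<omega>}"
    using isolated_value_pair_large_level[OF iso] unfolding y_def by blast
  have "\<forall>\<^sub>F l in sequentially.
    \<forall>j\<in>Aper (p l) x. \<forall>k\<in>Aper (p l) x. j \<noteq> k \<longrightarrow> 2 * J + 1 \<le> \<bar>j - k\<bar>"
    using assms(4) unfolding separated_holes_def by blast
  \<comment> \<open>Positions in a window of radius \<open>J\<close> differ by at most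
    \<open>2 * J\<close>, so distance \<open>2 * J + 1\<close> excludes a second hole.\<close>
  then obtain M where M: "\<And>l j k. l \<ge> M \<Longrightarrow> j \<in> Aper (p l) x \<Longrightarrow> k \<in> Aper (p l) x \<Longrightarrow> j \<noteq> k
    \<Longrightarrow> 2 * J + 1 \<le> \<bar>j - k\<bar>"
    unfolding eventually_sequentially by blast
  define l where "l = max L M"
  have isol: "{\<omega>' \<in> cylinder p \<omega> l. (\<omega>', a) \<in> graph_closure p y \<and> (\<omega>', b) \<in> graph_closure p y}
    = {\<omega>}"
    by (rule L) (simp add: l_def)
  then have \<omega>a: "(\<omega>, a) \<in> graph_closure p y" and \<omega>b: "(\<omega>, b) \<in> graph_closure p y" by blast+
  have const: "x (i + m) = x (j + m)"
    if "\<omega> l + m \<in> Per (p l) x" "i mod int (p l) = \<omega> l" "j mod int (p l) = \<omega> l" for m i j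
    using Per_mod_eq[OF that(1), of "i + m"] Per_mod_eq[OF that(1), of "j + m"] that(2,3)
    by (metis mod_add_left_eq)
  have "\<exists>k. \<bar>k\<bar> \<le> J \<and> \<omega> l + k \<notin> Per (p l) x"
  proof (rule ccontr)
    assume "\<not> ?thesis"
    then have "y i = y j" if "i mod int (p l) = \<omega> l" "j mod int (p l) = \<omega> l" for i j
      using const that by (intro code) blast
    then show False
      using \<omega>a \<omega>b \<open>a \<noteq> b\<close> unfolding graph_closure_iff[OF dvd \<omega>] by metis
  qed
  then obtain k where k: "\<bar>k\<bar> \<le> J" "\<omega> l + k \<notin> Per (p l) x" by blast
  have only: "\<omega> l + m \<in> Per (p l) x" if "\<bar>m\<bar> \<le> J" "m \<noteq> k" for m
  proof (rule ccontr)
    assume "\<omega> l + m \<notin> Per (p l) x"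
    then have "2 * J + 1 \<le> \<bar>(\<omega> l + m) - (\<omega> l + k)\<bar>"
      using k(2) that(2) by (intro M) (auto simp: Aper_def l_def)
    then show False using that(1) k(1) by linarith
  qed
  \<comment> \<open>Off the hole the two windows agree by periodicity, at the hole by
    assumption.\<close>
  have code': "y i = y j"
    if "i mod int (p l) = \<omega> l" "j mod int (p l) = \<omega> l" "x (i + k) = x (j + k)" for i j
    using const only that by (intro code) metis
  define \<omega>' where "\<omega>' = odometer_add p \<omega> k"
  have \<omega>': "\<omega>' \<in> odometer p"
    unfolding \<omega>'_def by (rule odometer_add_in_odometer[OF pos dvd \<omega>])
  obtain c where \<omega>c: "(\<omega>', c) \<in> graph_closure p x"
    and c: "\<And>l. \<exists>j. j mod int (p l) = \<omega> l \<and> x (j + k) = c \<and> y j = a"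
    using graph_closure_lift[OF pos dvd \<omega> \<omega>a] unfolding \<omega>'_def by metis
  obtain d where \<omega>d: "(\<omega>', d) \<in> graph_closure p x"
    and d: "\<And>l. \<exists>j. j mod int (p l) = \<omega> l \<and> x (j + k) = d \<and> y j = b"
    using graph_closure_lift[OF pos dvd \<omega> \<omega>b] unfolding \<omega>'_def by metis
  \<comment> \<open>The witnesses at level \<open>l\<close> lie in one residue class, so equal
    letters at the hole would force \<open>a = b\<close> by \<open>code'\<close>.\<close>
  have "c \<noteq> d" using c[of l] d[of l] code' \<open>a \<noteq> b\<close> by metis
  \<comment> \<open>One occurrence of \<open>f\<close> with output \<open>e\<close> fixes the output
    of \<open>f\<close> on the whole residue class, so values \<open>f\<close> over
    \<open>\<zeta>\<close> become values \<open>e\<close> over the translate.\<close>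
  have push: "(odometer_add p \<zeta> (-k), e) \<in> graph_closure p y"
    if \<zeta>: "\<zeta> \<in> cylinder p \<omega>' l" "(\<zeta>, f) \<in> graph_closure p x"
      and f: "\<exists>j. j mod int (p l) = \<omega> l \<and> x (j + k) = f \<and> y j = e" for \<zeta> e f
  proof -
    have \<zeta>_in: "\<zeta> \<in> odometer p" using \<zeta>(1) by (simp add: cylinder_def)
    obtain i where i: "i mod int (p l) = \<omega> l" "x (i + k) = f" "y i = e" using f by blast
    have "\<exists>j. j mod int (p n) = odometer_add p \<zeta> (-k) n \<and> y j = e" for n
    proof -
      \<comment> \<open>Level \<open>l\<close> is needed for \<open>code'\<close>, level
        \<open>n\<close> for the approximation of the translated point.\<close>
      obtain j where j: "j mod int (p (max l n)) = \<zeta> (max l n)" "x j = f"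
        using \<zeta>(2) unfolding graph_closure_iff[OF dvd \<zeta>_in] by blast
      have jn: "j mod int (p n) = \<zeta> n" and jl: "j mod int (p l) = \<zeta> l"
        using mod_odometer_mono[OF dvd \<zeta>_in _ j(1)] by auto
      have "j mod int (p l) = \<omega>' l" using jl \<zeta>(1) by (simp add: cylinder_def)
      then have "(j + -k) mod int (p l) = \<omega> l"
        using mod_eq_odometer_add[of j p l \<omega>' "-k"] \<omega>
        by (simp add: \<omega>'_def odometer_add_add odometer_add_0)
      then have "y (j + -k) = e" using code'[of "j + -k" i] i j(2) by simp
      then show ?thesis using mod_eq_odometer_add[of j p n \<zeta> "-k"] jn by blast
    qed
    then show ?thesis
      unfolding graph_closure_iff[OF dvd odometer_add_in_odometer[OF pos dvd \<zeta>_in]] by blast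
  qed
  have "\<zeta> = \<omega>'"
    if \<zeta>: "\<zeta> \<in> cylinder p \<omega>' l" "(\<zeta>, c) \<in> graph_closure p x" "(\<zeta>, d) \<in> graph_closure p x" for \<zeta>
  proof -
    have \<zeta>_in: "\<zeta> \<in> odometer p" using \<zeta>(1) by (simp add: cylinder_def)
    have "odometer_add p \<zeta> (-k) i = odometer_add p \<omega>' (-k) i" if "i \<le> l" for i
      using \<zeta>(1) that by (simp add: cylinder_def odometer_add_def)
    then have "odometer_add p \<zeta> (-k) \<in> cylinder p \<omega> l"
      using odometer_add_in_odometer[OF pos dvd \<zeta>_in] \<omega>
      by (simp add: cylinder_def \<omega>'_def odometer_add_add odometer_add_0)
    then have "odometer_add p \<zeta> (-k) = \<omega>"
      using isol push[OF \<zeta>(1,2) c] push[OF \<zeta>(1,3) d] by blast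
    then have "odometer_add p (odometer_add p \<zeta> (-k)) k = \<omega>'" by (simp add: \<omega>'_def)
    then show ?thesis by (simp add: odometer_add_add odometer_add_0[OF \<zeta>_in])
  qed
  moreover have "\<omega>' \<in> cylinder p \<omega>' l" using \<omega>' by (simp add: cylinder_def)
  ultimately have
    "{\<zeta> \<in> cylinder p \<omega>' l. (\<zeta>, c) \<in> graph_closure p x \<and> (\<zeta>, d) \<in> graph_closure p x} = {\<omega>'}"
    using \<omega>c \<omega>d by blast
  then have "isolated_value_pair p x \<omega>' c d"
    using \<open>c \<noteq> d\<close> unfolding isolated_value_pair_def by blast
  moreover have "\<omega>' \<in> nonsingleton_points p x"
    using \<omega>' \<omega>c \<omega>d \<open>c \<noteq> d\<close>
    by (auto simp: nonsingleton_points_def graph_fibre_def is_singleton_def set_eq_iff) metis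
  ultimately show ?thesis by blast
qed

end
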